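(* Let $1\le p<\infty$. Let $\Gamma\subseteq\mathbb{S}^{N-1}$ be such that $\mathcal{H}^{N-1}(\Gamma)>0$, let $\rho\ge0$, and define the infinite cone-like set $$K_{\Gamma,\rho}=\{x\in\mathbb{R}^N : \rho<|x|\text{ and }x/|x|\in\Gamma\}.$$ Suppose that $U\subseteq\mathbb{R}^N$ is open and that $K_{\Gamma,\rho}\subseteq U$. Then there exists a function $$u\in\bigcap_{0<s<1}\tilde{W}^{s,p}_{(1)}(U)\setminus\bigcup_{0<s<1}\dot{W}^{s,p}(U).$$ In particular, if $0<s<1$, then $\dot{W}^{s,p}(U)\subsetneqq\tilde{W}^{s,p}_{(1)}(U)$.
   Context: $\mathbb{S}^{N-1}$ is the unit sphere in $\mathbb{R}^N$ and $\mathcal{H}^{N-1}$ the $(N-1)$-dimensional Hausdorff measure. For $U\subseteq\mathbb{R}^N$ open, $0<s<1$ and $1\le p<\infty$: $\dot{W}^{s,p}(U)$ is the space of $f\in L^1_{\mathrm{loc}}(U)$ with $\int_U\int_U\frac{|f(y)-f(x)|^p}{|y-x|^{sp+N}}\,dy\,dx<\infty$; and for the constant screening function $1$, $\tilde{W}^{s,p}_{(1)}(U)$ is the space of $f\in L^1_{\mathrm{loc}}(U)$ with $\int_U\int_{B(x,1)\cap U}\frac{|f(y)-f(x)|^p}{|y-x|^{sp+N}}\,dy\,dx<\infty$, where $B(x,r)$ is the open ball of center $x$ and radius $r$. *)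

theory Defs
  imports "HOL-Analysis.Analysis"
begin

text \<open>
  \<open>k\<close>-dimensional Hausdorff outer measure, defined on all sets and normalised so that
  \<open>hausdorff_measure DIM('a)\<close> is Lebesgue outer measure. The weight of the empty set is \<open>0\<close> also for
  \<open>k = 0\<close>, where every nonempty set has weight \<open>0 ^ 0 = 1\<close> or \<open>d ^ 0 = 1\<close>, giving the counting measure.
  Covering sets are required to be bounded because \<open>diameter\<close> is meaningless on unbounded sets.
\<close>

definition hausdorff_weight :: "nat \<Rightarrow> 'a::metric_space set \<Rightarrow> real" where
  "hausdorff_weight k C = (if C = {} then 0 else unit_ball_vol (real k) * (diameter C / 2) ^ k)"

definition hausdorff_premeasure :: "nat \<Rightarrow> real \<Rightarrow> 'a::metric_space set \<Rightarrow> ennreal" where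
  "hausdorff_premeasure k \<delta> E =
     (INF C \<in> {C :: nat \<Rightarrow> 'a set. (\<forall>i. bounded (C i) \<and> diameter (C i) \<le> \<delta>) \<and> E \<subseteq> (\<Union>i. C i)}.
        (\<Sum>i. ennreal (hausdorff_weight k (C i))))"

definition hausdorff_measure :: "nat \<Rightarrow> 'a::metric_space set \<Rightarrow> ennreal" where
  "hausdorff_measure k E = (SUP \<delta> \<in> {0<..}. hausdorff_premeasure k \<delta> E)"

text \<open>
  Functions on \<open>U\<close> are represented by total functions whose values outside \<open>U\<close> are irrelevant;
  every condition below depends only on the almost-everywhere class of the restriction to \<open>U\<close>.
\<close>

definition L1_loc :: "'a::euclidean_space set \<Rightarrow> ('a \<Rightarrow> real) set" where
  "L1_loc U = {f. \<forall>K. compact K \<and> K \<subseteq> U \<longrightarrow> f absolutely_integrable_on K}"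

text \<open>On the diagonal \<open>x = y\<close> the quotient is \<open>0 / 0 = 0\<close>.\<close>

definition gagliardo_kernel :: "real \<Rightarrow> real \<Rightarrow> ('a::euclidean_space \<Rightarrow> real) \<Rightarrow> 'a \<Rightarrow> 'a \<Rightarrow> real" where
  "gagliardo_kernel s p f x y =
     \<bar>f y - f x\<bar> powr p / norm (y - x) powr (s * p + real DIM('a))"

definition homogeneous_sobolev ::
    "real \<Rightarrow> real \<Rightarrow> 'a::euclidean_space set \<Rightarrow> ('a \<Rightarrow> real) set" where
  "homogeneous_sobolev s p U =
     {f \<in> L1_loc U.
        (\<integral>\<^sup>+x\<in>U. (\<integral>\<^sup>+y\<in>U. ennreal (gagliardo_kernel s p f x y) \<partial>lebesgue) \<partial>lebesgue) < \<infinity>}"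

text \<open>The screening function \<open>\<sigma>\<close> gives the radius within which differences are measured.\<close>

definition screened_sobolev ::
    "('a::euclidean_space \<Rightarrow> real) \<Rightarrow> real \<Rightarrow> real \<Rightarrow> 'a set \<Rightarrow> ('a \<Rightarrow> real) set" where
  "screened_sobolev \<sigma> s p U =
     {f \<in> L1_loc U.
        (\<integral>\<^sup>+x\<in>U. (\<integral>\<^sup>+y\<in>ball x (\<sigma> x) \<inter> U. ennreal (gagliardo_kernel s p f x y) \<partial>lebesgue)
           \<partial>lebesgue) < \<infinity>}"

definition cone_like :: "'a::real_normed_vector set \<Rightarrow> real \<Rightarrow> 'a set" where
  "cone_like \<Gamma> \<rho> = {x. \<rho> < norm x \<and> x /\<^sub>R norm x \<in> \<Gamma>}"

end

theory Submission
  imports Defs "HOL-Real_Asymp.Real_Asymp"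
begin

text \<open>
  Take \<open>u x = g \<bar>x\<bar>\<close> with \<open>g' = w\<close> positive, decreasing and
  \<open>w r powr p = r powr (- N) / (1 + ln r)\<^sup>2\<close> for \<open>r \<ge> 1\<close>. Since \<open>w \<bar>x\<bar> powr p\<close> is (just)
  integrable at infinity, the Lipschitz bound on unit balls makes every screened seminorm finite.
  On the other hand the parts of \<open>U\<close> at distance about \<open>r\<close> and about \<open>3 r\<close> from the origin have
  measure at least \<open>c * r powr N\<close>, and \<open>u\<close> differs by at least \<open>r * w (3 r)\<close> between them, so their
  interaction contributes a constant times \<open>r powr ((1 - s) * p) / (1 + ln (3 * r))\<^sup>2\<close> to the
  homogeneous seminorm, which is unbounded in \<open>r\<close>. The lower bound on the measure holds because a
  set \<open>\<Gamma>\<close> whose cone shell is Lebesgue null has vanishing Hausdorff measure.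
\<close>

section \<open>Hausdorff measure and Lebesgue null cone shells\<close>

text \<open>A bounded null set lies in countably many nonoverlapping dyadic subcubes of one large
  cube, with arbitrarily small total volume. For a cube the \<open>DIM('a)\<close>-th power of the
  diameter is at most a dimensional constant times the volume, so these powers have small sums; a
  bound on the sums also caps each single diameter.\<close>

lemma negligible_cover_small_diameters:
  fixes S :: "'a::euclidean_space set"
  assumes "negligible S" "bounded S" "0 < \<delta>" "0 < e"
  obtains C :: "nat \<Rightarrow> 'a set"
  where "\<And>i. bounded (C i)" "\<And>i. diameter (C i) \<le> \<delta>" "S \<subseteq> (\<Union>i. C i)"
    "\<And>n. (\<Sum>i<n. diameter (C i) ^ DIM('a)) \<le> e"
proof -
  let ?N = "DIM('a)"
  obtain R where R: "R > 0" "S \<subseteq> ball 0 R"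
    using \<open>bounded S\<close> by (metis bounded_subset_ballD)
  define a :: 'a where "a = - (R *\<^sub>R One)"
  define b :: 'a where "b = R *\<^sub>R One"
  \<comment> \<open>The divisor \<open>real ?N ^ ?N\<close> pays for the estimate of a cube's
    diameter by \<open>?N\<close> times its side. The minimum keeps the sums below
    \<open>\<delta> ^ ?N\<close> as well, which bounds every individual diameter by
    \<open>\<delta>\<close>.\<close>
  define e' where "e' = min e (\<delta> ^ ?N) / real ?N ^ ?N"
  have e': "e' > 0" using assms by (simp add: e'_def)
  have Sab: "S \<subseteq> cbox a b"
  proof
    fix x assume "x \<in> S"
    then have "norm x < R" using R by auto
    then have "\<bar>x \<bullet> i\<bar> \<le> R" if "i \<in> Basis" for i
      using Basis_le_norm[OF that, of x] by linarith
    then show "x \<in> cbox a b" by (force simp: mem_box a_def b_def abs_le_iff)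
  qed
  have side: "b \<bullet> i - a \<bullet> i = 2 * R" if "i \<in> Basis" for i
    using that by (simp add: a_def b_def)
  obtain \<D> where D: "countable \<D>"
      "\<And>K. K \<in> \<D> \<Longrightarrow> K \<subseteq> cbox a b \<and> K \<noteq> {} \<and> (\<exists>c d. K = cbox c d)"
      "pairwise (\<lambda>A B. interior A \<inter> interior B = {}) \<D>"
      "\<And>u v. cbox u v \<in> \<D> \<Longrightarrow> \<exists>n. \<forall>i \<in> Basis. v \<bullet> i - u \<bullet> i = (b \<bullet> i - a \<bullet> i)/2^n"
      "S \<subseteq> \<Union>\<D>" "\<Union>\<D> \<in> lmeasurable" "measure lebesgue (\<Union>\<D>) \<le> measure lebesgue S + e'"
    using measurable_outer_intervals_bounded[OF negligible_imp_measurable[OF assms(1)] Sab e']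
    by metis
  have meas: "measure lebesgue (\<Union>\<D>) \<le> e'"
    using D(7) negligible_imp_measure0[OF assms(1)] by simp
  have diam: "bounded K \<and> diameter K ^ ?N \<le> real ?N ^ ?N * measure lebesgue K" if KD: "K \<in> \<D>" for K
  proof -
    obtain c d where K: "K = cbox c d" "cbox c d \<noteq> {}" using D(2)[OF KD] by auto
    obtain n where n: "\<And>i. i \<in> Basis \<Longrightarrow> d \<bullet> i - c \<bullet> i = 2 * R / 2^n"
      using D(4)[of c d] KD K side by auto
    define s where "s = 2 * R / 2^n"
    have s: "s > 0" using R by (simp add: s_def)
    have "diameter K \<le> ?N * s"
    proof (rule diameter_le)
      fix x y assume xy: "x \<in> K" "y \<in> K"
      have "norm (x - y) \<le> (\<Sum>i\<in>Basis. \<bar>(x - y) \<bullet> i\<bar>)" by (rule norm_le_l1)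
      also have "\<dots> \<le> (\<Sum>i\<in>(Basis::'a set). s)"
      proof (rule sum_mono)
        fix i :: 'a assume i: "i \<in> Basis"
        show "\<bar>(x - y) \<bullet> i\<bar> \<le> s"
          using xy i n[OF i] unfolding K mem_box s_def[symmetric] 
          by (fastforce simp: abs_le_iff inner_diff_left)
      qed
      finally show "norm (x - y) \<le> ?N * s" by simp
    qed (use s in auto)
    moreover have "measure lebesgue K = s ^ ?N"
    proof -
      have "\<forall>i\<in>Basis. c \<bullet> i \<le> d \<bullet> i" using K(2) by (simp add: box_ne_empty)
      then have "measure lebesgue K = (\<Prod>i\<in>Basis. d \<bullet> i - c \<bullet> i)"
        using K(2) by (simp add: K(1) content_cbox_if)
      also have "\<dots> = (\<Prod>i\<in>(Basis::'a set). s)" by (rule prod.cong) (auto simp: n s_def)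
      finally show ?thesis by simp
    qed
    moreover have "bounded K" by (simp add: K)
    ultimately show ?thesis
      by (metis diameter_ge_0 power_mono power_mult_distrib)
  qed
  let ?I = "to_nat_on \<D> ` \<D>"
  \<comment> \<open>A finite family is padded with empty sets, which have diameter 0.\<close>
  define C where "C i = (if i \<in> ?I then from_nat_into \<D> i else {})" for i
  have CD: "C i \<in> \<D>" if "i \<in> ?I" for i
    using that D(1) by (auto simp: C_def)
  have CU: "(\<Union>i. C i) = \<Union>\<D>"
  proof
    show "(\<Union>i. C i) \<subseteq> \<Union>\<D>"
    proof
      fix x assume "x \<in> (\<Union>i. C i)"
      then obtain i where i: "x \<in> C i" by auto
      then have "i \<in> ?I" unfolding C_def by (cases "i \<in> ?I") simp_all
      then show "x \<in> \<Union>\<D>" using i CD by blast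
    qed
    show "\<Union>\<D> \<subseteq> (\<Union>i. C i)"
    proof
      fix x assume "x \<in> \<Union>\<D>"
      then obtain K where K: "x \<in> K" "K \<in> \<D>" by auto
      then have "C (to_nat_on \<D> K) = K" using D(1) by (simp add: C_def)
      with K show "x \<in> (\<Union>i. C i)" by blast
    qed
  qed
  have bC: "bounded (C i)" for i
    using diam[OF CD, of i] by (cases "i \<in> ?I") (simp_all add: C_def)
  have dC: "diameter (C i) ^ ?N \<le> real ?N ^ ?N * measure lebesgue (C i)" for i
    using diam[OF CD, of i] by (cases "i \<in> ?I") (simp_all add: C_def diameter_def zero_power)
  have mC: "C i \<in> lmeasurable" for i
  proof (cases "i \<in> ?I")
    case True
    then obtain c d where "C i = cbox c d" using CD D(2) by metis
    then show ?thesis by simp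
  qed (simp add: C_def)
  have neg: "pairwise (\<lambda>i j. negligible (C i \<inter> C j)) UNIV"
    unfolding pairwise_def
  proof (intro ballI impI)
    fix i j :: nat assume ij: "i \<noteq> j"
    show "negligible (C i \<inter> C j)"
    proof (cases "i \<in> ?I \<and> j \<in> ?I")
      case True
      then have "C i \<noteq> C j" using ij D(1) by (auto simp: C_def)
      \<comment> \<open>Two distinct cubes meet in a convex set without interior. Such a set is
        null, so volumes of finite unions add up.\<close>
      then have int: "interior (C i) \<inter> interior (C j) = {}"
        using D(3) CD True unfolding pairwise_def by blast
      obtain c d c' d' where "C i = cbox c d" "C j = cbox c' d'" using CD True D(2) by metis
      with int show ?thesis
        by (metis convex_Int convex_box(1) interior_Int negligible_convex_interior)
    qed (auto simp: C_def)
  qed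
  have sumC: "(\<Sum>i<n. diameter (C i) ^ ?N) \<le> min e (\<delta> ^ ?N)" for n
  proof -
    have "(\<Sum>i<n. diameter (C i) ^ ?N) \<le> (\<Sum>i<n. real ?N ^ ?N * measure lebesgue (C i))"
      by (rule sum_mono) (rule dC)
    also have "\<dots> = real ?N ^ ?N * measure lebesgue (\<Union>(C ` {..<n}))"
      using mC neg by (subst measure_negligible_finite_Union_image)
        (auto simp: sum_distrib_left pairwise_def)
    also have "\<dots> \<le> real ?N ^ ?N * measure lebesgue (\<Union>\<D>)"
      using D(6) mC CU by (intro mult_left_mono measure_mono_fmeasurable) (auto simp: fmeasurableD)
    also have "\<dots> \<le> real ?N ^ ?N * e'" using meas by (intro mult_left_mono) auto
    also have "\<dots> = min e (\<delta> ^ ?N)" by (simp add: e'_def)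
    finally show ?thesis .
  qed
  have "diameter (C i) \<le> \<delta>" for i
  proof -
    have "diameter (C i) ^ ?N \<le> (\<Sum>i<Suc i. diameter (C i) ^ ?N)"
      using bC by (auto intro!: sum_nonneg zero_le_power diameter_ge_0)
    also have "\<dots> \<le> \<delta> ^ ?N" using sumC[of "Suc i"] by simp
    finally show ?thesis using assms(3) by (meson DIM_positive less_imp_le power_le_imp_le_base power_mono_iff diameter_ge_0 bC)
  qed
  moreover have "(\<Sum>i<n. diameter (C i) ^ ?N) \<le> e" for n using sumC[of n] by simp
  ultimately show ?thesis using that bC CU D(5) by metis
qed

text \<open>For every radius \<open>t\<close>, rescaled slices of a cover of the shell cover \<open>\<Gamma>\<close>. A set
  of diameter \<open>d\<close> meets the sphere of radius \<open>t\<close> only for \<open>t\<close> in an interval of length \<open>2 d\<close>, so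
  averaging over \<open>t\<close> trades one power of the diameter.\<close>

lemma hausdorff_null_of_negligible_shell:
  fixes \<Gamma> :: "'a::euclidean_space set"
  assumes \<Gamma>: "\<Gamma> \<subseteq> sphere 0 1"
    and neg: "negligible (cone_like \<Gamma> 1 \<inter> ball 0 2)"
  shows "hausdorff_measure (DIM('a) - 1) \<Gamma> = 0"
proof -
  let ?k = "DIM('a) - 1"
  define c where "c = unit_ball_vol (real ?k)"
  have c: "c > 0" by (simp add: c_def)
  have small: "hausdorff_premeasure ?k \<delta> \<Gamma> \<le> ennreal (3 * c * e)" if de: "\<delta> > 0" "e > 0" for \<delta> e
  proof -
    obtain C :: "nat \<Rightarrow> 'a set" where C: "\<And>i. bounded (C i)" "\<And>i. diameter (C i) \<le> \<delta>"
      "cone_like \<Gamma> 1 \<inter> ball 0 2 \<subseteq> (\<Union>i. C i)"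
      "\<And>n. (\<Sum>i<n. diameter (C i) ^ DIM('a)) \<le> e"
      using negligible_cover_small_diameters[OF neg _ de] by auto
    have d0: "diameter (C i) \<ge> 0" for i using C(1) by (rule diameter_ge_0)
    \<comment> \<open>\<open>z i\<close> is the norm of an arbitrary point of \<open>C i\<close>; by
      the reverse triangle inequality the norms of all other points of \<open>C i\<close> differ
      from it by at most the diameter.\<close>
    define z where "z i = norm (SOME x. x \<in> C i)" for i
    define J where "J i = {z i - diameter (C i) .. z i + diameter (C i)}" for i
    \<comment> \<open>\<open>f i t\<close> bounds the \<open>?k\<close>-dimensional weight of the
      slice of \<open>C i\<close> at radius \<open>t\<close>, and vanishes when \<open>J i\<close>
      rules out such a slice.\<close>
    define f where "f i t = ennreal (c * (diameter (C i) / 2) ^ ?k) * indicator (J i) t" for i t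
    have J: "norm x \<in> J i" if "x \<in> C i" for x i
    proof -
      have "(SOME x. x \<in> C i) \<in> C i" using that by (rule someI)
      from diameter_bounded_bound[OF C(1) that this]
      show ?thesis using norm_triangle_ineq3[of x "SOME x. x \<in> C i"]
        by (auto simp: J_def z_def dist_norm)
    qed
    have If: "(\<integral>\<^sup>+t. f i t \<partial>lborel) \<le> ennreal (2 * c * diameter (C i) ^ DIM('a))" for i
    proof -
      have "(\<integral>\<^sup>+t. f i t \<partial>lborel) = ennreal (c * (diameter (C i) / 2) ^ ?k) * ennreal (2 * diameter (C i))"
        unfolding f_def J_def using d0[of i] by (subst nn_integral_cmult_indicator) auto
      also have "\<dots> = ennreal (c * (diameter (C i) / 2) ^ ?k * (2 * diameter (C i)))"
        using c d0[of i] by (simp add: ennreal_mult)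
      \<comment> \<open>The factor 1/2 is dropped; the length of \<open>J i\<close> then raises the
        exponent from \<open>?k\<close> to \<open>DIM('a)\<close>.\<close>
      also have "\<dots> \<le> ennreal (c * diameter (C i) ^ ?k * (2 * diameter (C i)))"
        using c d0[of i] by (intro ennreal_leI mult_right_mono mult_left_mono power_mono) auto
      also have "c * diameter (C i) ^ ?k * (2 * diameter (C i)) = 2 * c * diameter (C i) ^ DIM('a)"
        using power_minus_mult[OF DIM_positive[where 'a='a], of "diameter (C i)"] by simp
      finally show ?thesis .
    qed
    have tot: "(\<integral>\<^sup>+t. (\<Sum>i. f i t) \<partial>lborel) \<le> ennreal (2 * c * e)"
    proof -
      have "(\<integral>\<^sup>+t. (\<Sum>i. f i t) \<partial>lborel) = (\<Sum>i. (\<integral>\<^sup>+t. f i t \<partial>lborel))"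
        by (rule nn_integral_suminf) (auto simp: f_def J_def)
      also have "\<dots> \<le> (\<Sum>i. ennreal (2 * c * diameter (C i) ^ DIM('a)))"
        by (intro suminf_le If) auto
      also have "\<dots> \<le> ennreal (2 * c * e)"
      proof (rule suminf_le_const)
        fix n
        have "(\<Sum>i<n. ennreal (2 * c * diameter (C i) ^ DIM('a))) =
            ennreal (2 * c * (\<Sum>i<n. diameter (C i) ^ DIM('a)))"
          using c d0 by (subst sum_ennreal) (auto simp: sum_distrib_left)
        also have "\<dots> \<le> ennreal (2 * c * e)" using c C(4) by (intro ennreal_leI mult_left_mono) auto
        finally show "(\<Sum>i<n. ennreal (2 * c * diameter (C i) ^ DIM('a))) \<le> ennreal (2 * c * e)" .
      qed auto
      finally show ?thesis .
    qed
    \<comment> \<open>Otherwise integrating over this interval of length 1 would give at least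
      \<open>3 * c * e\<close>, more than the total \<open>2 * c * e\<close>.\<close>
    have "\<exists>t\<in>{1<..<2}. (\<Sum>i. f i t) < ennreal (3 * c * e)"
    proof (rule ccontr)
      assume "\<not> ?thesis"
      then have *: "\<And>t. t \<in> {1<..<2} \<Longrightarrow> ennreal (3 * c * e) \<le> (\<Sum>i. f i t)" by (meson not_less)
      have "ennreal (3 * c * e) = (\<integral>\<^sup>+t. ennreal (3 * c * e) * indicator {1<..<2::real} t \<partial>lborel)"
        by (subst nn_integral_cmult_indicator) auto
      also have "\<dots> \<le> (\<integral>\<^sup>+t. (\<Sum>i. f i t) \<partial>lborel)"
        using * by (intro nn_integral_mono) (auto simp: indicator_def)
      also note tot
      finally have "3 * c * e \<le> 2 * c * e" using c de by (subst (asm) ennreal_le_iff) auto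
      then show False using c de by simp
    qed
    then obtain t where t: "1 < t" "t < 2" "(\<Sum>i. f i t) < ennreal (3 * c * e)" by auto
    \<comment> \<open>\<open>D i\<close> is the slice of \<open>C i\<close> at radius
      \<open>t\<close>, projected back to the unit sphere. As \<open>t > 1\<close>, the projection
      shrinks distances, so diameters do not grow.\<close>
    define D where "D i = {x \<in> sphere 0 1. t *\<^sub>R x \<in> C i}" for i
    have bD: "bounded (D i)" for i
      by (rule bounded_subset[OF bounded_sphere[of 0 1]]) (auto simp: D_def)
    have dD: "diameter (D i) \<le> diameter (C i)" for i
    proof (rule diameter_le)
      fix x y assume "x \<in> D i" "y \<in> D i"
      then have "norm (t *\<^sub>R x - t *\<^sub>R y) \<le> diameter (C i)"
        using diameter_bounded_bound[OF C(1)] by (auto simp: D_def dist_norm)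
      then have "t * norm (x - y) \<le> diameter (C i)" using t
        by (simp flip: scaleR_diff_right)
      moreover have "norm (x - y) \<le> t * norm (x - y)" using t mult_right_mono[of 1 t "norm (x - y)"] by simp
      ultimately show "norm (x - y) \<le> diameter (C i)" by simp
    qed (use d0 in auto)
    have cov: "\<Gamma> \<subseteq> (\<Union>i. D i)"
    proof
      fix x assume x: "x \<in> \<Gamma>"
      then have nx: "norm x = 1" using \<Gamma> by auto
      then have "t *\<^sub>R x \<in> cone_like \<Gamma> 1 \<inter> ball 0 2" using t x by (simp add: cone_like_def)
      then show "x \<in> (\<Union>i. D i)" using C(3) nx unfolding D_def by auto
    qed
    have hw: "hausdorff_weight ?k (D i) \<le> c * (diameter (C i) / 2) ^ ?k * indicator (J i) t" for i
    proof (cases "D i = {}")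
      \<comment> \<open>An empty slice has weight 0 even in dimension one, where
        \<open>?k = 0\<close> and the power alone would give 1.\<close>
      case True then show ?thesis using c d0[of i] by (simp add: hausdorff_weight_def)
    next
      case False
      then obtain x where "norm x = 1" "t *\<^sub>R x \<in> C i" by (auto simp: D_def)
      then have "t \<in> J i" using J[of "t *\<^sub>R x" i] t by simp
      then show ?thesis using False c dD[of i] diameter_ge_0[OF bD[of i]]
        unfolding hausdorff_weight_def c_def by (auto intro!: mult_left_mono power_mono)
    qed
    have w: "ennreal (hausdorff_weight ?k (D i)) \<le> f i t" for i
      using ennreal_leI[OF hw[of i]] by (cases "t \<in> J i") (auto simp: f_def)
    have "hausdorff_premeasure ?k \<delta> \<Gamma> \<le> (\<Sum>i. ennreal (hausdorff_weight ?k (D i)))"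
      unfolding hausdorff_premeasure_def
      using bD dD C(2) cov by (intro INF_lower) (auto intro: order_trans)
    also have "\<dots> \<le> (\<Sum>i. f i t)" by (intro suminf_le w) auto
    finally show ?thesis using t(3) by simp
  qed
  have "hausdorff_premeasure ?k \<delta> \<Gamma> = 0" if "\<delta> > 0" for \<delta>
  proof -
    have "hausdorff_premeasure ?k \<delta> \<Gamma> \<le> 0 + ennreal e" if "e > 0" for e
      using small[OF \<open>\<delta> > 0\<close>, of "e / (3 * c)"] c that by simp
    then have "hausdorff_premeasure ?k \<delta> \<Gamma> \<le> 0" by (rule ennreal_le_epsilon) 
    then show ?thesis by simp
  qed
  then show ?thesis unfolding hausdorff_measure_def by (simp add: SUP_constant)
qed

section \<open>Dyadic estimates of integrals\<close>

text \<open>This replaces polar coordinates: at each point a single term of the series already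
  dominates \<open>f\<close>. Overlaps among the \<open>S k\<close> only enlarge the bound, so full
  balls can serve in place of annuli.\<close>

lemma nn_integral_le_suminf_cover:
  fixes f :: "'a \<Rightarrow> ennreal" and b :: "nat \<Rightarrow> ennreal"
  assumes "\<And>x. x \<in> space M \<Longrightarrow> f x \<noteq> 0 \<Longrightarrow> \<exists>k. x \<in> S k \<and> f x \<le> b k"
    and "\<And>k. S k \<in> sets M"
  shows "(\<integral>\<^sup>+x. f x \<partial>M) \<le> (\<Sum>k. b k * emeasure M (S k))"
proof -
  have "(\<integral>\<^sup>+x. f x \<partial>M) \<le> (\<integral>\<^sup>+x. (\<Sum>k. b k * indicator (S k) x) \<partial>M)"
  proof (rule nn_integral_mono)
    fix x assume x: "x \<in> space M"
    show "f x \<le> (\<Sum>k. b k * indicator (S k) x)"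
    proof (cases "f x = 0")
      case False
      with assms(1) x obtain k where "x \<in> S k" "f x \<le> b k" by blast
      then have "f x \<le> (\<Sum>j\<in>{k}. b j * indicator (S j) x)" by simp
      also have "\<dots> \<le> (\<Sum>j. b j * indicator (S j) x)" by (intro sum_le_suminf) auto
      finally show ?thesis .
    qed simp
  qed
  also have "\<dots> = (\<Sum>k. b k * emeasure M (S k))"
    using assms(2) by (subst nn_integral_suminf) (auto simp: nn_integral_cmult_indicator)
  finally show ?thesis .
qed

lemma emeasure_lebesgue_ball:
  "0 \<le> r \<Longrightarrow> emeasure lebesgue (ball (c :: 'a::euclidean_space) r) =
     ennreal (unit_ball_vol DIM('a) * r ^ DIM('a))"
  by (simp add: emeasure_ball)

text \<open>Where the distance to \<open>x\<close> is between \<open>(1/2) ^ Suc k\<close> and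
  \<open>(1/2) ^ k\<close>, the integrand is at most \<open>b k\<close>, whose growth cancels
  against the volume of the ball of radius \<open>(1/2) ^ k\<close>. What remains is a geometric
  series of ratio \<open>q\<close>, and nothing in it depends on \<open>x\<close>.\<close>

lemma nn_integral_norm_powr_ball_finite:
  assumes "0 < \<epsilon>"
  obtains C :: real where "0 \<le> C"
    "\<And>x :: 'a::euclidean_space.
       (\<integral>\<^sup>+y\<in>ball x 1. ennreal (norm (y - x) powr (\<epsilon> - real DIM('a))) \<partial>lebesgue) \<le> ennreal C"
proof -
  let ?N = "DIM('a)"
  define q where "q = (1/2) powr \<epsilon>"
  have q: "0 < q" "q < 1" using assms powr_less_mono2[of \<epsilon> "1/2" 1] by (auto simp: q_def)
  define A where "A = unit_ball_vol (real ?N) * 2 ^ ?N"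
  have A: "A \<ge> 0" by (simp add: A_def)
  define b where "b k = q ^ k * (2 ^ Suc k) ^ ?N" for k
  \<comment> \<open>The radius is \<open>(1/2) ^ k\<close>, written so that its power cancels
    against that of \<open>2 ^ Suc k\<close> in \<open>b k\<close>.\<close>
  define S :: "'a \<Rightarrow> nat \<Rightarrow> 'a set" where "S x k = ball x (2 * (1/2) ^ Suc k)" for x k
  have "(\<integral>\<^sup>+y\<in>ball x 1. ennreal (norm (y - x) powr (\<epsilon> - real DIM('a))) \<partial>lebesgue)
      \<le> ennreal (A * (1 / (1 - q)))" for x :: 'a
  proof -
    have "(\<integral>\<^sup>+y\<in>ball x 1. ennreal (norm (y - x) powr (\<epsilon> - real DIM('a))) \<partial>lebesgue)
        \<le> (\<Sum>k. ennreal (b k) * emeasure lebesgue (S x k))"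
    proof (rule nn_integral_le_suminf_cover)
      fix y :: 'a
      assume "ennreal (norm (y - x) powr (\<epsilon> - real DIM('a))) * indicator (ball x 1) y \<noteq> 0"
      \<comment> \<open>Since \<open>0 powr a = 0\<close>, the integrand vanishes at the
        center.\<close>
      then have y: "y \<in> ball x 1" "y \<noteq> x" by (auto simp: indicator_def)
      define r where "r = norm (y - x)"
      have r: "0 < r" "r < 1" using y by (auto simp: r_def dist_norm norm_minus_commute)
      \<comment> \<open>The least such \<open>j\<close> locates the annulus of \<open>y\<close>; it
        is positive because \<open>r < 1\<close>, so the series can be indexed by its predecessor
        \<open>k\<close>.\<close>
      define j where "j = (LEAST j. (1/2) ^ j \<le> r)"
      obtain j0 where "(1/2::real) ^ j0 < r" using real_arch_pow_inv[of r "1/2"] r by auto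
      then have j: "(1/2) ^ j \<le> r" unfolding j_def by (metis LeastI less_imp_le)
      have "j \<noteq> 0" using j r by (cases j) auto
      then obtain k where k: "j = Suc k" by (cases j) auto
      have k2: "r < (1/2) ^ k" using not_less_Least[of k "\<lambda>j. (1/2) ^ j \<le> r"] k
        by (simp add: j_def)
      have "r powr (\<epsilon> - real ?N) = r powr \<epsilon> * (1 / r) ^ ?N"
        using r by (simp add: powr_diff powr_realpow power_divide)
      also have "\<dots> \<le> q ^ k * (2 ^ Suc k) ^ ?N"
      proof (intro mult_mono power_mono)
        have "r powr \<epsilon> \<le> ((1/2) ^ k) powr \<epsilon>" using r k2 assms by (intro powr_mono2) auto
        also have "\<dots> = q ^ k"
          by (simp only: q_def powr_powr mult.commute flip: powr_realpow[of "1/2"] powr_realpow[of "(1/2) powr \<epsilon>"])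
             (simp add: powr_powr mult.commute flip: powr_realpow)
        finally show "r powr \<epsilon> \<le> q ^ k" .
        show "1 / r \<le> 2 ^ Suc k" using j k r by (simp add: field_simps power_one_over)
      qed (use q r in auto)
      finally have "ennreal (norm (y - x) powr (\<epsilon> - real DIM('a))) \<le> ennreal (b k)"
        by (simp add: b_def r_def ennreal_leI)
      moreover have "y \<in> S x k" using k2 by (simp add: S_def r_def dist_norm norm_minus_commute)
      ultimately show "\<exists>k. y \<in> S x k \<and> ennreal (norm (y - x) powr (\<epsilon> - real DIM('a))) * indicator (ball x 1) y \<le> ennreal (b k)"
        using y by auto
    qed (simp add: S_def)
    also have "\<dots> = (\<Sum>k. ennreal (A * q ^ k))"
    proof (rule suminf_cong)
      fix k
      have "b k * (unit_ball_vol ?N * (2 * (1/2) ^ Suc k) ^ ?N) = A * q ^ k * (2 ^ k * (1/2) ^ k) ^ ?N"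
        by (simp add: b_def A_def power_mult_distrib)
      also have "\<dots> = A * q ^ k" by (simp flip: power_mult_distrib)
      finally have "b k * (unit_ball_vol ?N * (2 * (1/2) ^ Suc k) ^ ?N) = A * q ^ k" .
      moreover have "emeasure lebesgue (S x k) = ennreal (unit_ball_vol ?N * (2 * (1/2) ^ Suc k) ^ ?N)"
        unfolding S_def by (rule emeasure_lebesgue_ball) simp
      moreover have "0 \<le> b k" using q by (simp add: b_def)
      ultimately show "ennreal (b k) * emeasure lebesgue (S x k) = ennreal (A * q ^ k)"
        by (metis ennreal_mult')
    qed
    also have "\<dots> = ennreal (A * (1 / (1 - q)))"
    proof (rule suminf_ennreal_eq)
      show "(\<lambda>k. A * q ^ k) sums (A * (1 / (1 - q)))"
        using q by (intro sums_mult geometric_sums) auto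
    qed (use A q in auto)
    finally show ?thesis .
  qed
  then show ?thesis using that[of "A * (1 / (1 - q))"] A q by auto
qed

section \<open>The logarithmic weight\<close>

text \<open>Truncation at 1 makes the weight continuous and decreasing on the whole line, with value
  1 to the left of 1, so that it can be evaluated at \<open>norm x - 1\<close> even when this is
  negative.\<close>

definition log_weight :: "nat \<Rightarrow> real \<Rightarrow> real" where
  "log_weight N r = 1 / (max r 1 ^ N * (1 + ln (max r 1))\<^sup>2)"

lemma log_weight_pos: "0 < log_weight N r"
proof -
  have "0 \<le> ln (max r 1)" by simp
  then have "0 < 1 + ln (max r 1)" by linarith
  then show ?thesis by (simp add: log_weight_def)
qed

lemma log_weight_antimono: "a \<le> b \<Longrightarrow> log_weight N b \<le> log_weight N a"
  unfolding log_weight_def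
  by (intro divide_left_mono mult_mono power_mono mult_pos_pos zero_less_power add_left_mono)
     (auto intro: add_pos_nonneg)

lemma continuous_on_log_weight: "continuous_on A (log_weight N)"
proof -
  have "0 \<le> ln (max x (1::real))" for x by simp
  then have "1 + ln (max x (1::real)) \<noteq> 0" for x by (smt (verit))
  then show ?thesis unfolding log_weight_def[abs_def] by (intro continuous_intros) (auto simp: max_def)
qed

text \<open>On the annulus where \<open>norm x\<close> is of order \<open>2 ^ k\<close>, the power
  in the weight cancels the volume and the logarithm leaves a multiple of
  \<open>1 / (Suc k)\<^sup>2\<close>, which is summable. Shifting the norm by 1 costs only
  constants.\<close>

lemma nn_integral_log_weight_finite:
  "(\<integral>\<^sup>+x. ennreal (log_weight DIM('a) (norm (x :: 'a::euclidean_space) - 1)) \<partial>lebesgue) < \<infinity>"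
proof -
  let ?N = "DIM('a)"
  define A where "A = unit_ball_vol (real ?N)"
  have A: "A \<ge> 0" by (simp add: A_def)
  \<comment> \<open>If \<open>norm x\<close> is at least \<open>2 ^ (k - 1)\<close> and
    \<open>k \<ge> 2\<close>, then \<open>norm x - 1\<close> is at least \<open>2 ^ k / 4\<close>.
    For \<open>k < 2\<close> the truncation gives \<open>b k = 1\<close>.\<close>
  define b where "b k = log_weight ?N (2 ^ k / 4)" for k
  define S :: "nat \<Rightarrow> 'a set" where "S k = ball 0 (2 ^ k)" for k
  \<comment> \<open>For \<open>k = m + 2\<close> the factor 16 is the square of the 4 in
    \<open>Suc k \<le> 4 * (1 + m * ln 2)\<close>.\<close>
  have b_bound: "b k \<le> 16 * ((4 / 2 ^ k) ^ ?N * (1 / (real (Suc k))\<^sup>2))" for k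
  proof (cases "k \<ge> 2")
    case True
    then obtain m where k: "k = m + 2" by (metis add.commute le_Suc_ex)
    have m1: "2 ^ k / 4 = (2::real) ^ m" by (simp add: k)
    have "max ((2::real) ^ m) 1 = 2 ^ m" by simp
    then have "b k = 1 / (2 ^ m) ^ ?N * (1 / (1 + ln (2 ^ m))\<^sup>2)"
      unfolding b_def m1 by (simp add: log_weight_def)
    also have "\<dots> \<le> 1 / (2 ^ m) ^ ?N * (16 * (1 / (real (Suc k))\<^sup>2))"
    proof (rule mult_left_mono)
      have "real (Suc k) / 4 \<le> 1 + m * ln 2"
        using ln2_ge_two_thirds mult_left_mono[of "2/3" "ln 2" "real m"] by (simp add: k)
      then have "(real (Suc k) / 4)\<^sup>2 \<le> (1 + m * ln 2)\<^sup>2" by (intro power_mono) auto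
      then have "1 / (1 + ln (2 ^ m))\<^sup>2 \<le> 1 / (real (Suc k) / 4)\<^sup>2"
        by (intro divide_left_mono) (auto simp: ln_realpow intro!: mult_pos_pos zero_less_power add_pos_nonneg)
      then show "1 / (1 + ln (2 ^ m))\<^sup>2 \<le> 16 * (1 / (real (Suc k))\<^sup>2)"
        by (simp add: power_divide)
    qed simp
    also have "1 / (2 ^ m) ^ ?N = (4 / (2::real) ^ k) ^ ?N" by (simp add: k power_divide)
    finally show ?thesis by (simp add: mult_ac)
  next
    case False
    then have k: "k = 0 \<or> k = 1" by auto
    have "b k \<le> 1" using k by (auto simp: b_def log_weight_def)
    moreover have "1 \<le> (4 / (2::real) ^ k) ^ ?N" using k by (intro one_le_power) auto
    moreover have "1 \<le> 16 * (1 / (real (Suc k))\<^sup>2)" using k by auto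
    ultimately have "1 * 1 \<le> (4 / (2::real) ^ k) ^ ?N * (16 * (1 / (real (Suc k))\<^sup>2))"
      by (intro mult_mono) auto
    also have "\<dots> = 16 * ((4 / 2 ^ k) ^ ?N * (1 / (real (Suc k))\<^sup>2))" by (simp only: mult.left_commute)
    finally show ?thesis using \<open>b k \<le> 1\<close> by linarith
  qed
  have "(\<integral>\<^sup>+x. ennreal (log_weight ?N (norm (x::'a) - 1)) \<partial>lebesgue) \<le> (\<Sum>k. ennreal (b k) * emeasure lebesgue (S k))"
  proof (rule nn_integral_le_suminf_cover)
    fix x :: 'a
    define k where "k = (LEAST k. norm x < 2 ^ k)"
    obtain k0 where "norm x < 2 ^ k0" using real_arch_pow[of 2 "norm x"] by auto
    then have k: "norm x < 2 ^ k" unfolding k_def by (rule LeastI)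
    have "log_weight ?N (norm x - 1) \<le> b k"
    proof (cases "k \<ge> 2")
      case True
      then obtain m where m: "k = m + 2" by (metis add.commute le_Suc_ex)
      have "\<not> norm x < 2 ^ (m + 1)" using not_less_Least[of "m + 1" "\<lambda>k. norm x < 2 ^ k"] m
        by (simp add: k_def)
      moreover have "(1::real) \<le> 2 ^ m" by simp
      moreover have "(2::real) ^ k / 4 = 2 ^ m" "(2::real) ^ (m + 1) = 2 * 2 ^ m" by (simp_all add: m)
      ultimately have "2 ^ k / 4 \<le> norm x - 1" by linarith
      then show ?thesis unfolding b_def by (rule log_weight_antimono)
    next
      case False
      then have "k = 0 \<or> k = 1" by auto
      then have "b k = log_weight ?N 1" by (auto simp: b_def log_weight_def)
      moreover have "log_weight ?N (norm x - 1) \<le> log_weight ?N 1" 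
        using log_weight_antimono[of 1 "norm x - 1" ?N] by (cases "norm x - 1 \<ge> 1") (auto simp: log_weight_def)
      ultimately show ?thesis by simp
    qed
    then show "\<exists>k. x \<in> S k \<and> ennreal (log_weight ?N (norm x - 1)) \<le> ennreal (b k)"
      using k by (intro exI[of _ k]) (auto simp: S_def ennreal_leI)
  qed (simp add: S_def)
  also have "\<dots> \<le> (\<Sum>k. ennreal (16 * 4 ^ ?N * A * (1 / (real (Suc k))\<^sup>2)))"
  proof (rule suminf_le)
    fix k
    have "b k * (A * (2 ^ k) ^ ?N) \<le> 16 * ((4 / 2 ^ k) ^ ?N * (1 / (real (Suc k))\<^sup>2)) * (A * (2 ^ k) ^ ?N)"
      using A by (intro mult_right_mono b_bound) auto
    also have "\<dots> = 16 * 4 ^ ?N * A * (1 / (real (Suc k))\<^sup>2)" by (simp add: power_divide)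
    finally have "ennreal (b k * (A * (2 ^ k) ^ ?N)) \<le> ennreal (16 * 4 ^ ?N * A * (1 / (real (Suc k))\<^sup>2))"
      by (rule ennreal_leI)
    moreover have "emeasure lebesgue (S k) = ennreal (A * (2 ^ k) ^ ?N)"
      unfolding S_def A_def by (rule emeasure_lebesgue_ball) simp
    moreover have "0 \<le> b k" using log_weight_pos[of ?N "2 ^ k / 4"] by (simp add: b_def)
    ultimately show "ennreal (b k) * emeasure lebesgue (S k) \<le> ennreal (16 * 4 ^ ?N * A * (1 / (real (Suc k))\<^sup>2))"
      by (metis ennreal_mult')
  qed auto
  also have "\<dots> < \<infinity>"
  proof -
    have "summable (\<lambda>k. 16 * 4 ^ ?N * A * (1 / (real (Suc k))\<^sup>2))"
      using inverse_squares_sums by (intro summable_mult) (auto simp: sums_iff)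
    then show ?thesis using A by (simp add: ennreal_suminf_neq_top less_top)
  qed
  finally show ?thesis .
qed

lemma integral_antimono_bounds:
  fixes w :: "real \<Rightarrow> real"
  assumes cont: "continuous_on UNIV w" and anti: "\<And>a b. a \<le> b \<Longrightarrow> w b \<le> w a"
    and "0 \<le> a" "a \<le> b"
  shows "(b - a) * w b \<le> integral {0..b} w - integral {0..a} w"
    and "integral {0..b} w - integral {0..a} w \<le> (b - a) * w a"
proof -
  have int: "w integrable_on {c..d}" for c d
    by (rule integrable_continuous_interval) (rule continuous_on_subset[OF cont], simp)
  have eq: "integral {0..b} w - integral {0..a} w = integral {a..b} w"
    using Henstock_Kurzweil_Integration.integral_combine[OF assms(3,4) int] by simp
  have "integral {a..b} (\<lambda>_. w b) \<le> integral {a..b} w"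
    by (rule integral_le) (use anti int in auto)
  then show "(b - a) * w b \<le> integral {0..b} w - integral {0..a} w"
    using eq assms(4) by simp
  have "integral {a..b} w \<le> integral {a..b} (\<lambda>_. w a)"
    by (rule integral_le) (use anti int in auto)
  then show "integral {0..b} w - integral {0..a} w \<le> (b - a) * w a"
    using eq assms(4) by simp
qed

section \<open>Volume of the shells of the open set\<close>

lemma cone_like_scaleR:
  assumes "x \<in> cone_like \<Gamma> 1" "0 < r" "\<rho> \<le> r"
  shows "r *\<^sub>R x \<in> cone_like \<Gamma> \<rho>"
proof -
  have "1 < norm x" using assms by (simp add: cone_like_def)
  then have "r * 1 < r * norm x" using assms(2) by (intro mult_strict_left_mono) auto
  moreover have "norm (r *\<^sub>R x) = r * norm x" using assms(2) by simp
  ultimately have "\<rho> < norm (r *\<^sub>R x)" using assms(3) by linarith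
  moreover have "(r *\<^sub>R x) /\<^sub>R norm (r *\<^sub>R x) = x /\<^sub>R norm x" using assms(2) by simp
  ultimately show ?thesis using assms(1) unfolding cone_like_def mem_Collect_eq by metis
qed

text \<open>By the contrapositive of \<open>hausdorff_null_of_negligible_shell\<close>, the cone
  shell between radii 1 and 2 is not null. It may be nonmeasurable, so \<open>c\<close> is taken as
  a lower bound for the measure of all its measurable supersets. The part of \<open>U\<close>
  between radii \<open>r\<close> and \<open>2 * r\<close>, scaled by \<open>1 / r\<close>, is an
  open superset, and scaling back produces the power of \<open>r\<close>.\<close>

lemma cone_shells_measure_ge:
  fixes \<Gamma> U :: "'a::euclidean_space set"
  assumes "\<Gamma> \<subseteq> sphere 0 1" "hausdorff_measure (DIM('a) - 1) \<Gamma> > 0" "open U" "cone_like \<Gamma> \<rho> \<subseteq> U"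
  obtains c where "0 < c"
    "\<And>r. 0 < r \<Longrightarrow> \<rho> \<le> r \<Longrightarrow>
       ennreal (c * r ^ DIM('a)) \<le> emeasure lebesgue (U \<inter> (ball 0 (2 * r) - cball 0 r))"
proof -
  have "\<not> negligible (cone_like \<Gamma> 1 \<inter> ball 0 2)"
    using hausdorff_null_of_negligible_shell[OF assms(1)] assms(2) by auto
  then obtain c where c: "c > 0"
    "\<And>T. cone_like \<Gamma> 1 \<inter> ball 0 2 \<subseteq> T \<Longrightarrow> T \<in> lmeasurable \<Longrightarrow> c \<le> measure lebesgue T"
    unfolding negligible_outer by (meson not_less)
  show ?thesis
  proof
    fix r :: real assume r: "0 < r" "\<rho> \<le> r"
    define V where "V = U \<inter> (ball 0 (2 * r) - cball 0 r)"
    have V: "open V" "bounded V"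
      unfolding V_def using assms(3) by (auto intro: bounded_subset[OF bounded_ball[of 0 "2 * r"]])
    have sub: "cone_like \<Gamma> 1 \<inter> ball 0 2 \<subseteq> (*\<^sub>R) (1 / r) ` V"
    proof
      fix x assume x: "x \<in> cone_like \<Gamma> 1 \<inter> ball 0 2"
      then have "r *\<^sub>R x \<in> U" using cone_like_scaleR r assms(4) by blast
      moreover have "norm x < 2" "1 < norm x" using x by (auto simp: cone_like_def)
      ultimately have "r *\<^sub>R x \<in> V" using r by (simp add: V_def)
      then show "x \<in> (*\<^sub>R) (1 / r) ` V" using r by (intro image_eqI[of _ _ "r *\<^sub>R x"]) auto
    qed
    have "c \<le> measure lebesgue ((*\<^sub>R) (1 / r) ` V)"
      using sub V r by (intro c(2) lmeasurable_open bounded_scaling open_scaling) auto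
    also have "\<dots> = (1 / r) ^ DIM('a) * measure lebesgue V"
      using measure_lebesgue_affine[of "1 / r" 0 V] r by simp
    finally have "c * r ^ DIM('a) \<le> measure lebesgue V"
      using r by (simp add: field_simps)
    then show "ennreal (c * r ^ DIM('a)) \<le> emeasure lebesgue (U \<inter> (ball 0 (2 * r) - cball 0 r))"
      unfolding V_def[symmetric] using lmeasurable_open[OF V(2,1)] by (simp add: emeasure_eq_measure2 ennreal_leI)
  qed (rule c)
qed

section \<open>Membership in the function spaces\<close>

lemma continuous_in_L1_loc:
  assumes "continuous_on UNIV f"
  shows "f \<in> L1_loc U"
  unfolding L1_loc_def
proof (clarify)
  fix K :: "'a set" assume "compact K" "K \<subseteq> U"
  then have "integrable lborel (\<lambda>x. indicator K x *\<^sub>R f x)"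
    using assms by (intro borel_integrable_compact) (auto intro: continuous_on_subset)
  then show "f absolutely_integrable_on K"
    unfolding set_integrable_def by (rule integrable_completion[THEN iffD2, rotated]) (use \<open>integrable lborel _\<close> in auto)
qed

lemma homogeneous_subset_screened: "homogeneous_sobolev s p U \<subseteq> screened_sobolev \<sigma> s p U"
proof
  fix f assume f: "f \<in> homogeneous_sobolev s p U"
  have "(\<integral>\<^sup>+x\<in>U. (\<integral>\<^sup>+y\<in>ball x (\<sigma> x) \<inter> U. ennreal (gagliardo_kernel s p f x y) \<partial>lebesgue) \<partial>lebesgue)
      \<le> (\<integral>\<^sup>+x\<in>U. (\<integral>\<^sup>+y\<in>U. ennreal (gagliardo_kernel s p f x y) \<partial>lebesgue) \<partial>lebesgue)"
    by (intro nn_integral_mono mult_right_mono) (auto simp: indicator_def)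
  then show "f \<in> screened_sobolev \<sigma> s p U"
    using f by (auto simp: homogeneous_sobolev_def screened_sobolev_def)
qed

section \<open>The radial function\<close>

text \<open>This is the slope \<open>w\<close> of the overview: the root is chosen so that its
  \<open>p\<close>-th power is the integrable weight.\<close>

definition log_slope :: "nat \<Rightarrow> real \<Rightarrow> real \<Rightarrow> real" where
  "log_slope N p r = log_weight N r powr (1 / p)"

lemma log_slope_pos: "0 < log_slope N p r"
  using log_weight_pos[of N r] by (simp add: log_slope_def)

lemma log_slope_powr: "1 \<le> p \<Longrightarrow> log_slope N p r powr p = log_weight N r"
  using log_weight_pos[of N r] by (simp add: log_slope_def powr_powr)

lemma log_slope_antimono: "1 \<le> p \<Longrightarrow> a \<le> b \<Longrightarrow> log_slope N p b \<le> log_slope N p a"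
  unfolding log_slope_def using log_weight_pos[of N b] log_weight_antimono[of a b N]
  by (intro powr_mono2) auto

lemma continuous_on_log_slope: "continuous_on A (log_slope N p)"
proof -
  have "log_weight N x \<noteq> 0" for x using log_weight_pos[of N x] by simp
  then show ?thesis unfolding log_slope_def[abs_def]
    by (intro continuous_on_powr continuous_on_log_weight continuous_on_const) auto
qed

definition radial_witness :: "real \<Rightarrow> 'a::euclidean_space \<Rightarrow> real" where
  "radial_witness p x = integral {0..norm x} (log_slope DIM('a) p)"

lemma radial_witness_diff:
  fixes x y :: "'a::euclidean_space"
  assumes "1 \<le> p" "norm x \<le> norm y"
  shows "(norm y - norm x) * log_slope DIM('a) p (norm y) \<le> radial_witness p y - radial_witness p x"
    and "radial_witness p y - radial_witness p x \<le> (norm y - norm x) * log_slope DIM('a) p (norm x)"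
  unfolding radial_witness_def
  by (rule integral_antimono_bounds; use assms log_slope_antimono continuous_on_log_slope in auto)+

lemma radial_witness_mono:
  fixes x y :: "'a::euclidean_space"
  assumes "1 \<le> p" "norm x \<le> norm y"
  shows "radial_witness p x \<le> radial_witness p y"
proof -
  have "0 \<le> (norm y - norm x) * log_slope DIM('a) p (norm y)"
    using assms(2) log_slope_pos[of "DIM('a)" p "norm y"] by simp
  then show ?thesis using radial_witness_diff(1)[OF assms] by linarith
qed

text \<open>The increment depends only on the two norms, so it is an integral of the decreasing
  slope over an interval to the right of \<open>r\<close>; that the region outside a ball is not
  convex does no harm. The constant decays as \<open>r\<close> grows, while \<open>r = 0\<close>
  yields global continuity.\<close>

lemma radial_witness_lipschitz:
  fixes x y :: "'a::euclidean_space"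
  assumes p: "1 \<le> p" and r: "r \<le> norm x" "r \<le> norm y"
  shows "\<bar>radial_witness p y - radial_witness p x\<bar> \<le> norm (y - x) * log_slope DIM('a) p r"
proof -
  have *: "\<bar>radial_witness p y - radial_witness p x\<bar> \<le> norm (y - x) * log_slope DIM('a) p r"
    if xy: "norm x \<le> norm y" "r \<le> norm x" for x y :: 'a
  proof -
    have "\<bar>radial_witness p y - radial_witness p x\<bar> = radial_witness p y - radial_witness p x"
      using radial_witness_mono[OF p xy(1)] by simp
    also have "\<dots> \<le> (norm y - norm x) * log_slope DIM('a) p (norm x)"
      by (rule radial_witness_diff(2)[OF p xy(1)])
    also have "\<dots> \<le> norm (y - x) * log_slope DIM('a) p r"
      using xy log_slope_antimono[OF p xy(2)] log_slope_pos[of "DIM('a)" p]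
      by (intro mult_mono norm_triangle_ineq2) (auto intro: less_imp_le)
    finally show ?thesis .
  qed
  show ?thesis
  proof (cases "norm x \<le> norm y")
    case False
    then show ?thesis using *[of y x] r by (simp add: abs_minus_commute norm_minus_commute)
  qed (use * r in auto)
qed

lemma continuous_on_radial_witness:
  assumes "1 \<le> p"
  shows "continuous_on UNIV (radial_witness p :: 'a::euclidean_space \<Rightarrow> real)"
proof -
  have "(log_slope DIM('a) p 0)-lipschitz_on UNIV (radial_witness p :: 'a \<Rightarrow> real)"
    using radial_witness_lipschitz[OF assms, of 0] less_imp_le[OF log_slope_pos]
    by (intro lipschitz_onI) (auto simp: dist_norm mult.commute)
  then show ?thesis by (rule lipschitz_on_continuous_on)
qed

section \<open>Finiteness of the screened seminorms\<close>

text \<open>On the unit ball about \<open>x\<close> all norms are at least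
  \<open>norm x - 1\<close>. The Lipschitz bound therefore dominates the kernel by a product of a
  weight in \<open>x\<close> and a power of \<open>norm (y - x)\<close>, whose integrals are finite
  by the two dyadic estimates.\<close>

lemma radial_witness_screened:
  fixes U :: "'a::euclidean_space set"
  assumes p: "1 \<le> p" and s: "0 < s" "s < 1"
  shows "radial_witness p \<in> screened_sobolev (\<lambda>_. 1) s p U"
proof -
  let ?N = "DIM('a)" and ?u = "radial_witness p :: 'a \<Rightarrow> real"
  \<comment> \<open>The Lipschitz bound contributes \<open>p\<close> powers of the distance and the
    kernel removes \<open>s * p + ?N\<close>; the surplus over \<open>- ?N\<close> is
    \<open>\<epsilon>\<close>, positive because \<open>s < 1\<close>.\<close>
  define \<epsilon> where "\<epsilon> = p * (1 - s)"
  have "\<epsilon> > 0" using p s by (simp add: \<epsilon>_def)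
  then obtain C where C: "0 \<le> C" "\<And>x :: 'a.
       (\<integral>\<^sup>+y\<in>ball x 1. ennreal (norm (y - x) powr (\<epsilon> - real ?N)) \<partial>lebesgue) \<le> ennreal C"
    by (rule nn_integral_norm_powr_ball_finite[where 'a='a]) blast
  let ?W = "\<lambda>x :: 'a. log_weight ?N (norm x - 1)"
  have ker: "gagliardo_kernel s p ?u x y \<le> ?W x * norm (y - x) powr (\<epsilon> - real ?N)"
    if "y \<in> ball x 1" for x y
  proof -
    have d: "norm (y - x) < 1" using that by (simp add: dist_norm norm_minus_commute)
    have "norm x - 1 \<le> norm y" using d norm_triangle_ineq3[of y x] by linarith
    then have "\<bar>?u y - ?u x\<bar> \<le> norm (y - x) * log_slope ?N p (norm x - 1)"
      by (intro radial_witness_lipschitz[OF p]) auto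
    then have "\<bar>?u y - ?u x\<bar> powr p \<le> (norm (y - x) * log_slope ?N p (norm x - 1)) powr p"
      using p by (intro powr_mono2) auto
    also have "\<dots> = norm (y - x) powr p * ?W x"
      using log_slope_pos[of ?N p] log_slope_powr[OF p] by (simp add: powr_mult less_imp_le)
    finally have "gagliardo_kernel s p ?u x y \<le> norm (y - x) powr p * ?W x / norm (y - x) powr (s * p + ?N)"
      unfolding gagliardo_kernel_def by (intro divide_right_mono) auto
    also have "\<dots> = ?W x * norm (y - x) powr (p - (s * p + ?N))"
      by (simp add: powr_diff)
    also have "p - (s * p + ?N) = \<epsilon> - ?N" by (simp add: \<epsilon>_def algebra_simps)
    finally show ?thesis .
  qed
  have inner: "(\<integral>\<^sup>+y\<in>ball x 1 \<inter> U. ennreal (gagliardo_kernel s p ?u x y) \<partial>lebesgue) \<le> ennreal (?W x) * ennreal C" for x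
  proof -
    have "(\<integral>\<^sup>+y\<in>ball x 1 \<inter> U. ennreal (gagliardo_kernel s p ?u x y) \<partial>lebesgue)
        \<le> (\<integral>\<^sup>+y. ennreal (?W x) * (ennreal (norm (y - x) powr (\<epsilon> - real ?N)) * indicator (ball x 1) y) \<partial>lebesgue)"
    proof (rule nn_integral_mono)
      fix y
      show "ennreal (gagliardo_kernel s p ?u x y) * indicator (ball x 1 \<inter> U) y
          \<le> ennreal (?W x) * (ennreal (norm (y - x) powr (\<epsilon> - real ?N)) * indicator (ball x 1) y)"
      proof (cases "y \<in> ball x 1 \<inter> U")
        case True
        then show ?thesis using ker[of y x] less_imp_le[OF log_weight_pos]
          by (simp add: ennreal_leI flip: ennreal_mult)
      qed simp
    qed
    also have "\<dots> = ennreal (?W x) * (\<integral>\<^sup>+y\<in>ball x 1. ennreal (norm (y - x) powr (\<epsilon> - real ?N)) \<partial>lebesgue)"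
    proof (rule nn_integral_cmult)
      have "(\<lambda>y. norm (y - x) powr (\<epsilon> - real ?N)) \<in> borel_measurable borel" by measurable
      then have "(\<lambda>y. ennreal (norm (y - x) powr (\<epsilon> - real ?N)) * indicator (ball x 1) y) \<in> borel_measurable borel"
        by (intro borel_measurable_times_ennreal borel_measurable_indicator measurable_compose[OF _ measurable_ennreal]) auto
      then show "(\<lambda>y. ennreal (norm (y - x) powr (\<epsilon> - real ?N)) * indicator (ball x 1) y) \<in> borel_measurable lebesgue"
        by (simp add: measurable_completion)
    qed
    also have "\<dots> \<le> ennreal (?W x) * ennreal C" by (intro mult_left_mono C(2)) simp
    finally show ?thesis .
  qed
  have "(\<integral>\<^sup>+x\<in>U. (\<integral>\<^sup>+y\<in>ball x 1 \<inter> U. ennreal (gagliardo_kernel s p ?u x y) \<partial>lebesgue) \<partial>lebesgue)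
      \<le> (\<integral>\<^sup>+x. ennreal (?W x) * ennreal C \<partial>lebesgue)"
    using inner by (intro nn_integral_mono) (auto simp: indicator_def)
  also have "\<dots> = (\<integral>\<^sup>+x. ennreal (?W x) \<partial>lebesgue) * ennreal C"
  proof (rule nn_integral_multc)
    have "continuous_on UNIV ?W"
      by (rule continuous_on_compose2[OF continuous_on_log_weight[of UNIV]]) (auto intro: continuous_intros)
    then have "?W \<in> borel_measurable borel" by (rule borel_measurable_continuous_onI)
    then have "(\<lambda>x. ennreal (?W x)) \<in> borel_measurable borel" by measurable
    then show "(\<lambda>x. ennreal (?W x)) \<in> borel_measurable lebesgue" by (simp add: measurable_completion)
  qed
  also have "\<dots> < \<infinity>" using nn_integral_log_weight_finite[where 'a='a]
    by (simp add: ennreal_mult_less_top)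
  finally show ?thesis
    unfolding screened_sobolev_def using continuous_in_L1_loc[OF continuous_on_radial_witness[OF p]] by simp
qed

section \<open>Divergence of the homogeneous seminorms\<close>

text \<open>Restricting the double integral to \<open>V r\<close> times \<open>V (3 * r)\<close>
  bounds it below by the product of both volumes and the least kernel value \<open>k r\<close>. The
  radii \<open>2 * r\<close> and \<open>3 * r\<close> leave a gap of width \<open>r\<close> between
  the shells, across which the function must rise.\<close>

lemma radial_witness_not_homogeneous:
  fixes U :: "'a::euclidean_space set"
  assumes p: "1 \<le> p" and s: "0 < s" "s < 1" and U: "open U"
    and c: "0 < c" "\<And>r. 0 < r \<Longrightarrow> \<rho> \<le> r \<Longrightarrow>
       ennreal (c * r ^ DIM('a)) \<le> emeasure lebesgue (U \<inter> (ball 0 (2 * r) - cball 0 r))"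
  shows "radial_witness p \<notin> homogeneous_sobolev s p U"
proof
  let ?N = "DIM('a)" and ?u = "radial_witness p :: 'a \<Rightarrow> real"
  define I where "I = (\<integral>\<^sup>+x\<in>U. (\<integral>\<^sup>+y\<in>U. ennreal (gagliardo_kernel s p ?u x y) \<partial>lebesgue) \<partial>lebesgue)"
  assume "?u \<in> homogeneous_sobolev s p U"
  then have fin: "I < \<infinity>" by (simp add: I_def homogeneous_sobolev_def)
  define V where "V r = U \<inter> (ball 0 (2 * r) - cball 0 r)" for r
  have V: "V r \<in> sets lebesgue" for r using U unfolding V_def by auto
  \<comment> \<open>The numerator is the \<open>p\<close>-th power of the rise
    \<open>r * log_slope ?N p (3 * r)\<close>; the distance is at most
    \<open>2 * r + 6 * r\<close>.\<close>
  define k where "k r = r powr p * log_weight ?N (3 * r) / (8 * r) powr (s * p + ?N)" for r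
  have k0: "k r \<ge> 0" for r using less_imp_le[OF log_weight_pos] by (simp add: k_def)
  have low: "ennreal (k r * (c * r ^ ?N) * (c * r ^ ?N)) \<le> I" if r: "0 < r" "\<rho> \<le> r" for r
  proof -
    have ker: "k r \<le> gagliardo_kernel s p ?u x y" if "x \<in> V r" "y \<in> V (3 * r)" for x y
    proof -
      have n: "norm x < 2 * r" "3 * r < norm y" "norm y < 6 * r"
        using that by (auto simp: V_def)
      \<comment> \<open>A unit vector supplies comparison points with norms exactly
        \<open>2 * r\<close> and \<open>3 * r\<close>, the edges of the gap.\<close>
      define e :: 'a where "e = (SOME i. i \<in> Basis)"
      have e: "norm e = 1" by (simp add: e_def SOME_Basis)
      have "r * log_slope ?N p (3 * r) \<le> ?u ((3 * r) *\<^sub>R e) - ?u ((2 * r) *\<^sub>R e)"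
        using radial_witness_diff(1)[OF p, of "(2 * r) *\<^sub>R e" "(3 * r) *\<^sub>R e"] r e by simp
      moreover have "?u x \<le> ?u ((2 * r) *\<^sub>R e)" "?u ((3 * r) *\<^sub>R e) \<le> ?u y"
        using n r e by (auto intro!: radial_witness_mono[OF p])
      ultimately have "r * log_slope ?N p (3 * r) \<le> \<bar>?u y - ?u x\<bar>" by linarith
      then have "(r * log_slope ?N p (3 * r)) powr p \<le> \<bar>?u y - ?u x\<bar> powr p"
        using p r log_slope_pos[of ?N p] by (intro powr_mono2) (auto intro: less_imp_le)
      then have num: "r powr p * log_weight ?N (3 * r) \<le> \<bar>?u y - ?u x\<bar> powr p"
        using r log_slope_pos[of ?N p] log_slope_powr[OF p] by (simp add: powr_mult less_imp_le)
      have "norm (y - x) \<le> 8 * r" using n norm_triangle_ineq4[of y x] by linarith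
      then have den: "norm (y - x) powr (s * p + ?N) \<le> (8 * r) powr (s * p + ?N)"
        using p s by (intro powr_mono2) auto
      \<comment> \<open>At equal points the kernel would be 0, and \<open>frac_le\<close> requires
        its denominator to be positive.\<close>
      have "y \<noteq> x" using n r by auto
      with num den show ?thesis
        unfolding k_def gagliardo_kernel_def using less_imp_le[OF log_weight_pos]
        by (intro frac_le) auto
    qed
    have "ennreal (k r * (c * r ^ ?N) * (c * r ^ ?N)) = ennreal (k r) * ennreal (c * r ^ ?N) * ennreal (c * r ^ ?N)"
      using k0 c r by (simp add: ennreal_mult)
    also have "\<dots> \<le> ennreal (k r) * emeasure lebesgue (V (3 * r)) * emeasure lebesgue (V r)"
    proof (intro mult_mono)
      show "ennreal (c * r ^ ?N) \<le> emeasure lebesgue (V r)" unfolding V_def using r by (rule c(2))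
      have "ennreal (c * r ^ ?N) \<le> ennreal (c * (3 * r) ^ ?N)"
        using c r by (intro ennreal_leI mult_left_mono power_mono) auto
      also have "\<dots> \<le> emeasure lebesgue (V (3 * r))" unfolding V_def using r by (intro c(2)) auto
      finally show "ennreal (c * r ^ ?N) \<le> emeasure lebesgue (V (3 * r))" .
    qed auto
    also have "\<dots> = (\<integral>\<^sup>+x\<in>V r. (\<integral>\<^sup>+y\<in>V (3 * r). ennreal (k r) \<partial>lebesgue) \<partial>lebesgue)"
      using V by (simp add: nn_integral_cmult_indicator)
    also have "\<dots> \<le> I"
      unfolding I_def
    proof (rule nn_integral_mono)
      fix x
      have "(\<integral>\<^sup>+y\<in>V (3 * r). ennreal (k r) \<partial>lebesgue) \<le> (\<integral>\<^sup>+y\<in>U. ennreal (gagliardo_kernel s p ?u x y) \<partial>lebesgue)"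
        if "x \<in> V r"
        using ker[OF that] by (intro nn_integral_mono) (auto simp: indicator_def V_def intro: ennreal_leI)
      then show "(\<integral>\<^sup>+y\<in>V (3 * r). ennreal (k r) \<partial>lebesgue) * indicator (V r) x
          \<le> (\<integral>\<^sup>+y\<in>U. ennreal (gagliardo_kernel s p ?u x y) \<partial>lebesgue) * indicator U x"
        by (auto simp: indicator_def V_def)
    qed
    finally show ?thesis .
  qed
  have bound: "k r * (c * r ^ ?N) * (c * r ^ ?N) \<le> enn2real I" if "0 < r" "\<rho> \<le> r" for r
  proof -
    have "I = ennreal (enn2real I)" using fin by (simp add: ennreal_enn2real)
    then show ?thesis using low[OF that] by (metis ennreal_le_iff enn2real_nonneg)
  qed
  define \<epsilon> where "\<epsilon> = p * (1 - s)"
  have \<epsilon>: "\<epsilon> > 0" using p s by (simp add: \<epsilon>_def)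
  \<comment> \<open>In the product, \<open>r ^ ?N\<close> from each shell cancels against the weight
    and the kernel, leaving \<open>r powr (p - s * p)\<close> over the squared logarithm. The 3
    stems from evaluating the weight at \<open>3 * r\<close>.\<close>
  define A where "A = c\<^sup>2 / (8 powr (s * p + ?N) * 3 ^ ?N)"
  have A: "A > 0" using c by (simp add: A_def)
  have eq: "k r * (c * r ^ ?N) * (c * r ^ ?N) = A * (r powr \<epsilon> / (1 + ln (3 * r))\<^sup>2)" if "r \<ge> 1" for r
  proof -
    have "r powr p = r powr \<epsilon> * r powr (s * p)"
      by (simp add: \<epsilon>_def algebra_simps flip: powr_add)
    moreover have "(8 * r) powr (s * p + ?N) = 8 powr (s * p + ?N) * (r powr (s * p) * r ^ ?N)"
      using that by (simp add: powr_mult powr_add powr_realpow)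
    moreover have "log_weight ?N (3 * r) = 1 / (3 ^ ?N * r ^ ?N * (1 + ln (3 * r))\<^sup>2)"
      using that by (simp add: log_weight_def power_mult_distrib max_def)
    ultimately have "k r = r powr \<epsilon> * r powr (s * p) * (1 / (3 ^ ?N * r ^ ?N * (1 + ln (3 * r))\<^sup>2))
        / (8 powr (s * p + ?N) * (r powr (s * p) * r ^ ?N))"
      unfolding k_def by simp
    moreover have "r powr (s * p) \<noteq> 0" "r ^ ?N \<noteq> 0" using that by auto
    ultimately show ?thesis by (simp add: A_def power2_eq_square mult_ac)
  qed
  have "filterlim (\<lambda>r. A * (r powr \<epsilon> / (1 + ln (3 * r))\<^sup>2)) at_top at_top"
    using A \<epsilon> by real_asymp
  then have "eventually (\<lambda>r. A * (r powr \<epsilon> / (1 + ln (3 * r))\<^sup>2) > enn2real I) at_top"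
    by (simp add: filterlim_at_top_dense)
  \<comment> \<open>Beyond \<open>\<rho>\<close> the shell bounds apply, and beyond 1 the explicit
    formula \<open>eq\<close> holds.\<close>
  moreover have "eventually (\<lambda>r. r \<ge> max 1 \<rho>) at_top" by (rule eventually_ge_at_top)
  ultimately have "eventually (\<lambda>r::real. False) at_top"
  proof eventually_elim
    case (elim r)
    then show False using bound[of r] eq[of r] by auto
  qed
  then show False by simp
qed

theorem theorem3p11:
  fixes p \<rho> :: real and \<Gamma> U :: "'a::euclidean_space set"
  assumes "1 \<le> p"
    and "\<Gamma> \<subseteq> sphere 0 1"
    and "hausdorff_measure (DIM('a) - 1) \<Gamma> > 0"
    and "0 \<le> \<rho>"
    and "open U"
    and "cone_like \<Gamma> \<rho> \<subseteq> U"
  shows "(\<exists>u. u \<in> (\<Inter>s\<in>{0<..<1}. screened_sobolev (\<lambda>_. 1) s p U)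
               - (\<Union>s\<in>{0<..<1}. homogeneous_sobolev s p U))
       \<and> (\<forall>s. 0 < s \<and> s < 1 \<longrightarrow>
               homogeneous_sobolev s p U \<subset> screened_sobolev (\<lambda>_. 1) s p U)"
proof -
  obtain c where c: "0 < c" "\<And>r. 0 < r \<Longrightarrow> \<rho> \<le> r \<Longrightarrow>
       ennreal (c * r ^ DIM('a)) \<le> emeasure lebesgue (U \<inter> (ball 0 (2 * r) - cball 0 r))"
    using cone_shells_measure_ge[OF assms(2,3,5,6)] by blast
  have scr: "radial_witness p \<in> screened_sobolev (\<lambda>_. 1) s p U" if "0 < s" "s < 1" for s
    using radial_witness_screened[OF assms(1) that] .
  have hom: "radial_witness p \<notin> homogeneous_sobolev s p U" if "0 < s" "s < 1" for s
    using radial_witness_not_homogeneous[OF assms(1) that assms(5) c] by blast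
  show ?thesis
  \<comment> \<open>One function serves every \<open>s\<close>, since
    \<open>radial_witness p\<close> depends only on \<open>p\<close> and the dimension.\<close>
  proof (intro conjI allI impI exI[of _ "radial_witness p"])
    fix s :: real assume "0 < s \<and> s < 1"
    then show "homogeneous_sobolev s p U \<subset> screened_sobolev (\<lambda>_. 1) s p U"
      using scr[of s] hom[of s] homogeneous_subset_screened by blast
  qed (use scr hom in auto)
qed

end
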